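(* Let $\mathbb{F}_q$ be the finite field of order $q$, let $n,m\ge 1$ be integers, and let $V \subseteq \mathbb{F}_q[x_1,\dots,x_n]$ be an $\mathbb{F}_q$-vector subspace which contains functions. Then the number of distinct common zeros in $\mathbb{F}_q^n$ of a system of random polynomials $f_1,\dots,f_m \in V$ is binomial with parameters $q^n$ and $1/q^m$. Explicitly, for an integer $r \ge 0$ let $P_{m,r}\subseteq V^m$ be the set of $m$-tuples $(f_1,\dots,f_m)$ such that $\#\{\mathbf{x}\in\mathbb{F}_q^n : f_1(\mathbf{x})=\cdots=f_m(\mathbf{x})=0\}=r$. If $V$ is finite-dimensional, then for all $r\ge 0$ $$\frac{|P_{m,r}|}{|V^m|}=\binom{q^n}{r}\left(\frac{1}{q^m}\right)^r\left(1-\frac{1}{q^m}\right)^{q^n-r},$$ and if $V$ is infinite-dimensional, then for all $r \ge 0$ the density $d_m(P_{m,r})$ exists and $$d_m(P_{m,r})=\binom{q^n}{r}\left(\frac{1}{q^m}\right)^r\left(1-\frac{1}{q^m}\right)^{q^n-r}.$$ (For $r>q^n$ the right-hand sides are understood to be $0$.)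
   Context: An $\mathbb{F}_q$-vector subspace $V \subseteq \mathbb{F}_q[x_1,\dots,x_n]$ is said to contain functions if every function $\mathbb{F}_q^n\to\mathbb{F}_q$ is represented by (i.e. is the evaluation function of) some polynomial in $V$. When $V$ is finite-dimensional (hence finite), a random system $(f_1,\dots,f_m)$ is drawn from $V^m$ with respect to the normalized counting measure. When $V$ is infinite-dimensional, probability is interpreted as asymptotic density: for an integer $t\ge 0$ let $V_t\subseteq V$ be the subspace of polynomials in $V$ of total degree at most $t$ (including $0$); for $A\subseteq V^m$ the density is $d_m(A)=\lim_{t\to\infty}|A\cap V_t^m|/|V_t^m|$, provided the limit exists. *)

theory Defs
  imports "HOL-Analysis.Finite_Cartesian_Product" "HOL-Library.Poly_Mapping"
begin

text \<open>
  Polynomials over \<open>'a\<close> in the variables \<open>x\<^sub>i\<close>, where \<open>i\<close> ranges over the finite type \<open>'n\<close>: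
  finitely supported maps from exponent vectors to coefficients.
\<close>

type_synonym ('n, 'a) mpoly = "('n \<Rightarrow>\<^sub>0 nat) \<Rightarrow>\<^sub>0 'a"

definition mpoly_scale :: "'a::field \<Rightarrow> ('n, 'a) mpoly \<Rightarrow> ('n, 'a) mpoly"
  where "mpoly_scale c p = Poly_Mapping.map ((*) c) p"

lemma lookup_mpoly_scale:
  "Poly_Mapping.lookup (mpoly_scale c p) k = c * Poly_Mapping.lookup p k"
  by (simp add: mpoly_scale_def Poly_Mapping.map.rep_eq when_def)

global_interpretation mpoly: vector_space "mpoly_scale :: 'a::field \<Rightarrow> ('n, 'a) mpoly \<Rightarrow> _"
  defines mpoly_subspace = mpoly.subspace
    and mpoly_span = mpoly.span
  by unfold_locales
    (rule poly_mapping_eqI; simp add: lookup_mpoly_scale lookup_add algebra_simps)+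

definition mpoly_finite_dim :: "('n, 'a::field) mpoly set \<Rightarrow> bool"
  where "mpoly_finite_dim V \<longleftrightarrow> (\<exists>B. finite B \<and> mpoly_span B = V)"

definition mpoly_eval :: "('n::finite, 'a::field) mpoly \<Rightarrow> 'a ^ 'n \<Rightarrow> 'a"
  where "mpoly_eval p x =
    (\<Sum>k\<in>Poly_Mapping.keys p.
      Poly_Mapping.lookup p k * (\<Prod>i\<in>UNIV. (x $ i) ^ Poly_Mapping.lookup k i))"

definition contains_functions :: "('n::finite, 'a::field) mpoly set \<Rightarrow> bool"
  where "contains_functions V \<longleftrightarrow> (\<forall>g :: 'a ^ 'n \<Rightarrow> 'a. \<exists>p\<in>V. mpoly_eval p = g)"

text \<open>The zero polynomial gets total degree 0, so it lies in every \<open>degree_le_part V t\<close>.\<close>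

definition total_degree :: "('n::finite, 'a::field) mpoly \<Rightarrow> nat"
  where "total_degree p =
    Max (insert 0 ((\<lambda>k. \<Sum>i\<in>UNIV. Poly_Mapping.lookup k i) ` Poly_Mapping.keys p))"

definition degree_le_part :: "('n::finite, 'a::field) mpoly set \<Rightarrow> nat \<Rightarrow> ('n, 'a) mpoly set"
  where "degree_le_part V t = {p \<in> V. total_degree p \<le> t}"

text \<open>The Cartesian power \<open>V\<^sup>m\<close>, with \<open>f 0, \<dots>, f (m - 1)\<close> as the components of a tuple \<open>f\<close>.\<close>

definition tuples :: "nat \<Rightarrow> 'b set \<Rightarrow> (nat \<Rightarrow> 'b) set"
  where "tuples m V = (\<Pi>\<^sub>E i\<in>{..<m}. V)"

definition has_density ::
    "nat \<Rightarrow> ('n::finite, 'a::field) mpoly set \<Rightarrow> (nat \<Rightarrow> ('n, 'a) mpoly) set \<Rightarrow> real \<Rightarrow> bool"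
  where "has_density m V A d \<longleftrightarrow>
    (\<lambda>t. real (card (A \<inter> tuples m (degree_le_part V t))) /
         real (card (tuples m (degree_le_part V t)))) \<longlonglongrightarrow> d"

definition common_zeros :: "nat \<Rightarrow> (nat \<Rightarrow> ('n::finite, 'a::field) mpoly) \<Rightarrow> ('a ^ 'n) set"
  where "common_zeros m f = {x. \<forall>i<m. mpoly_eval (f i) x = 0}"

definition systems_with_zeros ::
    "nat \<Rightarrow> ('n::finite, 'a::field) mpoly set \<Rightarrow> nat \<Rightarrow> (nat \<Rightarrow> ('n, 'a) mpoly) set"
  where "systems_with_zeros m V r = {f \<in> tuples m V. card (common_zeros m f) = r}"

end

theory Submission
  imports Defs
begin

text \<open>
  Evaluation is additive. Restricted to a finite subspace \<open>W\<close> that contains functions it is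
  therefore a surjective group homomorphism onto the functions \<open>\<bbbF>\<^sub>q\<^sup>n \<rightarrow> \<bbbF>\<^sub>q\<close>, so all its fibres have
  the same size (\<open>card_eval_fibre\<close>): drawing \<open>f\<close> uniformly from \<open>W\<close> and evaluating it yields a
  uniformly random function. An \<open>m\<close>-tuple drawn from \<open>W\<close> thus yields a uniformly random map from
  \<open>\<bbbF>\<^sub>q\<^sup>n\<close> to \<open>\<bbbF>\<^sub>q\<^sup>m\<close>, whose values at the \<open>q\<^sup>n\<close> points are independent and each vanish with
  probability \<open>1 / q\<^sup>m\<close>. This is the binomial distribution; \<open>card_value_tuples_with_zeros\<close> carries
  out the count, one prescribed zero set at a time.

  A finite-dimensional \<open>V\<close> is finite, and the count applies with \<open>W = V\<close>. In general, the part
  \<open>V\<^sub>t\<close> of \<open>V\<close> of total degree at most \<open>t\<close> is a finite subspace. There are only finitely many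
  functions to represent, so \<open>V\<^sub>t\<close> contains functions as soon as \<open>t\<close> is large
  (\<open>eventually_contains_functions\<close>). The sequence that defines the density is therefore eventually
  constant, equal to the binomial probability.
\<close>

section \<open>Evaluation\<close>

lemma mpoly_eval_superset:
  assumes "finite K" and "Poly_Mapping.keys p \<subseteq> K"
  shows "mpoly_eval p x =
    (\<Sum>k\<in>K. Poly_Mapping.lookup p k * (\<Prod>i\<in>UNIV. (x $ i) ^ Poly_Mapping.lookup k i))"
  unfolding mpoly_eval_def
  using assms by (intro sum.mono_neutral_left) (auto simp: in_keys_iff)

lemma mpoly_eval_add: "mpoly_eval (p + q) x = mpoly_eval p x + mpoly_eval q x"
proof -
  let ?K = "Poly_Mapping.keys p \<union> Poly_Mapping.keys q"
  have "Poly_Mapping.keys (p + q) \<subseteq> ?K"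
    by (rule Poly_Mapping.keys_add)
  then show ?thesis
    by (simp add: mpoly_eval_superset[of ?K] lookup_add distrib_right sum.distrib)
qed

lemma mpoly_eval_diff: "mpoly_eval (p - q) x = mpoly_eval p x - mpoly_eval q x"
  using mpoly_eval_add[of "p - q" q x] by simp

text \<open>The fibre over \<open>g\<close> is a translate, by any polynomial of \<open>W\<close> representing \<open>g\<close>, of the kernel.\<close>

lemma card_eval_fibre:
  fixes W :: "('n::finite, 'a::field) mpoly set"
  assumes "mpoly_subspace W" and "contains_functions W"
  shows "card {p \<in> W. mpoly_eval p = g} = card {p \<in> W. mpoly_eval p = (\<lambda>x. 0)}"
proof -
  obtain p0 where p0: "p0 \<in> W" "mpoly_eval p0 = g"
    using assms(2) by (auto simp: contains_functions_def)
  have "bij_betw (\<lambda>p. p + p0) {p \<in> W. mpoly_eval p = (\<lambda>x. 0)} {p \<in> W. mpoly_eval p = g}"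
    by (rule bij_betw_byWitness[where f' = "\<lambda>p. p - p0"])
      (use p0 mpoly.subspace_add[OF assms(1)] mpoly.subspace_diff[OF assms(1)]
        in \<open>auto simp: fun_eq_iff mpoly_eval_add mpoly_eval_diff\<close>)
  then show ?thesis
    by (simp add: bij_betw_same_card)
qed

section \<open>Counting tuples of functions by their common zeros\<close>

definition value_tuples :: "nat \<Rightarrow> (nat \<Rightarrow> 'x \<Rightarrow> 'a) set"
  where "value_tuples m = (\<Pi>\<^sub>E i\<in>{..<m}. UNIV)"

text \<open>
  Read as a single map into \<open>\<bbbF>\<^sub>q\<^sup>m\<close>, the tuple has value \<open>0\<close> at the points of \<open>S\<close> and may take any
  of the \<open>q\<^sup>m - 1\<close> other values independently at each point outside \<open>S\<close>.
\<close>

lemma card_value_tuples_zero_set: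
  fixes S :: "'x::finite set"
  shows "card {G \<in> value_tuples m. {x. \<forall>i<m. G i x = (0::'a::{zero,finite})} = S} =
    (CARD('a) ^ m - 1) ^ (CARD('x) - card S)"
proof -
  let ?A = "(\<Pi>\<^sub>E i\<in>{..<m}. UNIV) :: (nat \<Rightarrow> 'a) set"
  let ?z = "(\<lambda>i\<in>{..<m}. 0) :: nat \<Rightarrow> 'a"
  let ?H = "\<Pi>\<^sub>E x\<in>(UNIV :: 'x set). if x \<in> S then {?z} else ?A - {?z}"
  let ?G = "{G \<in> value_tuples m. {x. \<forall>i<m. G i x = (0::'a)} = S}"
  have z: "?z \<in> ?A"
    by auto
  have zero_iff: "(\<lambda>i\<in>{..<m}. G i x) = ?z \<longleftrightarrow> (\<forall>i<m. G i x = 0)" for G :: "nat \<Rightarrow> 'x \<Rightarrow> 'a" and x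
    by (auto simp: fun_eq_iff restrict_def)
  have H: "h x \<in> (if x \<in> S then {?z} else ?A - {?z})" if "h \<in> ?H" for h x
    using that by (rule PiE_mem) simp
  have inA: "h x \<in> ?A" if "h \<in> ?H" for h x
    using H[OF that, of x] z by (cases "x \<in> S") simp_all
  \<comment> \<open>Swapping the arguments turns a tuple of functions into a map to tuples; the restriction to
    indices below \<open>m\<close> keeps the values extensional.\<close>
  have "bij_betw (\<lambda>G x. \<lambda>i\<in>{..<m}. G i x) ?G ?H"
  proof (rule bij_betw_byWitness[where f' = "\<lambda>h. \<lambda>i\<in>{..<m}. \<lambda>x. h x i"])
    show "\<forall>G\<in>?G. (\<lambda>i\<in>{..<m}. \<lambda>x. (\<lambda>i\<in>{..<m}. G i x) i) = G"
      by (auto simp: value_tuples_def fun_eq_iff PiE_iff extensional_def restrict_def)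
    show "\<forall>h\<in>?H. (\<lambda>x. \<lambda>i\<in>{..<m}. (\<lambda>i\<in>{..<m}. \<lambda>x. h x i) i x) = h"
    proof
      fix h assume "h \<in> ?H"
      then have "h x \<in> extensional {..<m}" for x
        using inA[of h x] by (simp add: PiE_iff)
      then show "(\<lambda>x. \<lambda>i\<in>{..<m}. (\<lambda>i\<in>{..<m}. \<lambda>x. h x i) i x) = h"
        by (auto simp: fun_eq_iff restrict_def extensional_def)
    qed
    show "(\<lambda>G x. \<lambda>i\<in>{..<m}. G i x) ` ?G \<subseteq> ?H"
      using zero_iff by (auto simp: PiE_iff simp del: restrict_apply)
    show "(\<lambda>h. \<lambda>i\<in>{..<m}. \<lambda>x. h x i) ` ?H \<subseteq> ?G"
    proof (rule image_subsetI)
      fix h assume h: "h \<in> ?H"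
      have "(\<forall>i<m. h x i = 0) \<longleftrightarrow> h x = ?z" for x
        using inA[OF h, of x] by (auto simp: fun_eq_iff PiE_iff extensional_def restrict_def)
      moreover have "h x = ?z \<longleftrightarrow> x \<in> S" for x
        using H[OF h, of x] by (cases "x \<in> S") simp_all
      ultimately show "(\<lambda>i\<in>{..<m}. \<lambda>x. h x i) \<in> ?G"
        by (auto simp: value_tuples_def)
    qed
  qed
  then have "card ?G = card ?H"
    by (rule bij_betw_same_card)
  also have "\<dots> = (\<Prod>x\<in>UNIV. if x \<in> S then 1 else CARD('a) ^ m - 1)"
  proof -
    have "card (?A - {?z}) = CARD('a) ^ m - 1"
      using z by (simp add: card_Diff_singleton card_PiE)
    then show ?thesis
      by (subst card_PiE) (auto intro!: prod.cong)
  qed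
  also have "\<dots> = (CARD('a) ^ m - 1) ^ card (- S)"
    by (simp add: prod.If_cases)
  also have "card (- S) = CARD('x) - card S"
    by (simp add: Compl_eq_Diff_UNIV card_Diff_subset)
  finally show ?thesis .
qed

lemma finite_value_tuples: "finite (value_tuples m :: (nat \<Rightarrow> 'x::finite \<Rightarrow> 'a::finite) set)"
  unfolding value_tuples_def by (intro finite_PiE) auto

lemma card_value_tuples_with_zeros:
  "card {G \<in> value_tuples m. card {x::'x::finite. \<forall>i<m. G i x = (0::'a::{zero,finite})} = r} =
    (CARD('x) choose r) * (CARD('a) ^ m - 1) ^ (CARD('x) - r)"
proof -
  let ?Z = "\<lambda>G::nat \<Rightarrow> 'x \<Rightarrow> 'a. {x. \<forall>i<m. G i x = 0}"
  have "card {G \<in> value_tuples m. card (?Z G) = r} =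
      card (\<Union>S\<in>{S. card S = r}. {G \<in> value_tuples m. ?Z G = S})"
    by (rule arg_cong[where f = card]) auto
  also have "\<dots> = (\<Sum>S\<in>{S. card S = r}. card {G \<in> value_tuples m. ?Z G = S})"
    by (rule card_UN_disjoint) (auto simp: finite_value_tuples)
  also have "\<dots> = (\<Sum>S::'x set\<in>{S. card S = r}. (CARD('a) ^ m - 1) ^ (CARD('x) - r))"
    by (rule sum.cong[OF refl]) (use card_value_tuples_zero_set[where 'a = 'a] in auto)
  also have "\<dots> = (CARD('x) choose r) * (CARD('a) ^ m - 1) ^ (CARD('x) - r)"
    using n_subsets[of "UNIV :: 'x set" r] by simp
  finally show ?thesis .
qed

section \<open>Finite subspaces that contain functions\<close>

text \<open>
  Componentwise evaluation sends tuples over \<open>W\<close> to tuples of functions; the fibre over a tuple \<open>G\<close>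
  is the product of the fibres over its components, hence of a size that does not depend on \<open>G\<close>.
\<close>

lemma card_tuples_eval:
  fixes W :: "('n::finite, 'a::{field,finite}) mpoly set"
  assumes "mpoly_subspace W" and "contains_functions W" and "finite W"
    and "T \<subseteq> value_tuples m"
  shows "card {f \<in> tuples m W. (\<lambda>i\<in>{..<m}. mpoly_eval (f i)) \<in> T} =
    card T * card {p \<in> W. mpoly_eval p = (\<lambda>x. 0)} ^ m"
proof -
  let ?F = "\<lambda>G. \<Pi>\<^sub>E i\<in>{..<m}. {p \<in> W. mpoly_eval p = G i}"
  have fibre: "(\<lambda>i\<in>{..<m}. mpoly_eval (f i)) = G \<longleftrightarrow> f \<in> ?F G"
    if "f \<in> tuples m W" "G \<in> T" for f G
    using that assms(4)
    by (fastforce simp: tuples_def value_tuples_def fun_eq_iff PiE_iff extensional_def restrict_def)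
  have sub: "f \<in> tuples m W" if "f \<in> ?F G" for f G
    using that by (auto simp: tuples_def PiE_iff)
  have "card {f \<in> tuples m W. (\<lambda>i\<in>{..<m}. mpoly_eval (f i)) \<in> T} = card (\<Union>G\<in>T. ?F G)"
    using fibre sub by (intro arg_cong[where f = card]) blast
  also have "\<dots> = (\<Sum>G\<in>T. card (?F G))"
  proof (rule card_UN_disjoint)
    show "finite T"
      using assms(4) finite_value_tuples finite_subset by blast
    show "\<forall>G\<in>T. finite (?F G)"
      using assms(3) by (auto intro!: finite_PiE)
    show "\<forall>G\<in>T. \<forall>G'\<in>T. G \<noteq> G' \<longrightarrow> ?F G \<inter> ?F G' = {}"
    proof (intro ballI impI)
      fix G G' assume "G \<in> T" "G' \<in> T" "G \<noteq> G'"
      show "?F G \<inter> ?F G' = {}"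
      proof (intro equals0I, elim IntE)
        fix f assume f: "f \<in> ?F G" "f \<in> ?F G'"
        note f_tuple = sub[OF f(1)]
        show False
          using fibre[OF f_tuple \<open>G \<in> T\<close>] fibre[OF f_tuple \<open>G' \<in> T\<close>] f \<open>G \<noteq> G'\<close>
          by argo
      qed
    qed
  qed
  also have "\<dots> = card T * card {p \<in> W. mpoly_eval p = (\<lambda>x. 0)} ^ m"
  proof -
    have "card (?F G) = (\<Prod>i<m. card {p \<in> W. mpoly_eval p = (\<lambda>x. 0)})" for G
      unfolding card_PiE[OF finite_lessThan]
      by (rule prod.cong[OF refl card_eval_fibre[OF assms(1,2)]])
    then show ?thesis
      by simp
  qed
  finally show ?thesis .
qed

lemma binomial_pmf_eq_count:
  fixes N Q r :: nat
  assumes "Q \<ge> 1"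
  shows "real ((N choose r) * (Q - 1) ^ (N - r)) / real Q ^ N =
    real (N choose r) * (1 / real Q) ^ r * (1 - 1 / real Q) ^ (N - r)"
proof (cases "r \<le> N")
  case True
  have "real Q ^ N = real Q ^ r * real Q ^ (N - r)"
    using True by (simp flip: power_add)
  moreover have "1 - 1 / real Q = (real Q - 1) / real Q"
    using assms by (simp add: field_simps)
  ultimately show ?thesis
    using assms by (simp add: power_divide of_nat_diff)
qed (simp add: binomial_eq_0)

lemma proportion_systems_with_zeros:
  fixes W :: "('n::finite, 'a::{field,finite}) mpoly set"
  assumes "mpoly_subspace W" and "contains_functions W" and "finite W"
  shows "real (card (systems_with_zeros m W r)) / real (card (tuples m W)) =
    real (CARD('a) ^ CARD('n) choose r) * (1 / real CARD('a) ^ m) ^ r *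
      (1 - 1 / real CARD('a) ^ m) ^ (CARD('a) ^ CARD('n) - r)"
proof -
  let ?N = "CARD('a) ^ CARD('n)" and ?Q = "CARD('a) ^ m"
  let ?K = "card {p \<in> W. mpoly_eval p = (\<lambda>x. 0)}"
  let ?T = "{G \<in> value_tuples m. card {x::'a ^ 'n. \<forall>i<m. G i x = (0::'a)} = r}"
  have N: "CARD('a ^ 'n) = ?N"
    by simp
  have value_tuple: "(\<lambda>i\<in>{..<m}. mpoly_eval (f i)) \<in> value_tuples m" for f :: "nat \<Rightarrow> ('n, 'a) mpoly"
    by (auto simp: value_tuples_def)
  have "systems_with_zeros m W r = {f \<in> tuples m W. (\<lambda>i\<in>{..<m}. mpoly_eval (f i)) \<in> ?T}"
    using value_tuple by (auto simp: systems_with_zeros_def common_zeros_def cong: conj_cong)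
  then have systems: "card (systems_with_zeros m W r) =
      (?N choose r) * (?Q - 1) ^ (?N - r) * ?K ^ m"
    using card_tuples_eval[OF assms, of ?T m]
    by (simp only: card_value_tuples_with_zeros N) auto
  have "tuples m W = {f \<in> tuples m W. (\<lambda>i\<in>{..<m}. mpoly_eval (f i)) \<in> value_tuples m}"
    using value_tuple by auto
  then have "card (tuples m W) = card (value_tuples m :: (nat \<Rightarrow> 'a ^ 'n \<Rightarrow> 'a) set) * ?K ^ m"
    using card_tuples_eval[OF assms, of "value_tuples m" m] by simp
  also have "card (value_tuples m :: (nat \<Rightarrow> 'a ^ 'n \<Rightarrow> 'a) set) = ?Q ^ ?N"
    by (simp add: value_tuples_def card_PiE card_fun power_mult mult.commute flip: power_mult)
  finally have total: "card (tuples m W) = ?Q ^ ?N * ?K ^ m" .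
  have "0 \<in> {p \<in> W. mpoly_eval p = (\<lambda>x. 0)}"
    using mpoly.subspace_0[OF assms(1)] by (auto simp: mpoly_eval_def)
  then have "?K \<noteq> 0"
    using assms(3) by (auto simp: card_eq_0_iff)
  then have "real (card (systems_with_zeros m W r)) / real (card (tuples m W)) =
      real ((?N choose r) * (?Q - 1) ^ (?N - r)) / real ?Q ^ ?N"
    by (simp add: systems total)
  also have "\<dots> = real (?N choose r) * (1 / real ?Q) ^ r * (1 - 1 / real ?Q) ^ (?N - r)"
    by (rule binomial_pmf_eq_count) simp
  finally show ?thesis
    by simp
qed

section \<open>Polynomials of bounded total degree\<close>

lemma total_degree_le_iff:
  "total_degree p \<le> t \<longleftrightarrow>
    (\<forall>k\<in>Poly_Mapping.keys p. (\<Sum>i\<in>UNIV. Poly_Mapping.lookup k i) \<le> t)"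
  by (simp add: total_degree_def)

text \<open>
  There are finitely many exponent vectors of degree at most \<open>t\<close>, and finitely many choices for
  the coefficient of each because the field is finite.
\<close>

lemma finite_total_degree_le:
  "finite {p :: ('n::finite, 'a::{field,finite}) mpoly. total_degree p \<le> t}"
proof -
  let ?M = "{k :: 'n \<Rightarrow>\<^sub>0 nat. (\<Sum>i\<in>UNIV. Poly_Mapping.lookup k i) \<le> t}"
  have "finite (Poly_Mapping.lookup ` ?M)"
  proof (rule finite_subset)
    show "Poly_Mapping.lookup ` ?M \<subseteq> (\<Pi>\<^sub>E i\<in>UNIV. {..t})"
    proof (clarsimp simp: PiE_iff)
      fix k :: "'n \<Rightarrow>\<^sub>0 nat" and i
      assume "(\<Sum>i\<in>UNIV. Poly_Mapping.lookup k i) \<le> t"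
      then show "Poly_Mapping.lookup k i \<le> t"
        using member_le_sum[of i UNIV "Poly_Mapping.lookup k"] by simp
    qed
  qed (simp add: finite_PiE)
  moreover have "inj_on Poly_Mapping.lookup ?M"
    by (simp add: inj_on_def lookup_inject)
  ultimately have M: "finite ?M"
    by (rule finite_imageD)
  have "finite (Poly_Mapping.lookup ` {p :: ('n, 'a) mpoly. total_degree p \<le> t})"
  proof (rule finite_subset)
    show "Poly_Mapping.lookup ` {p :: ('n, 'a) mpoly. total_degree p \<le> t} \<subseteq>
        {f. \<forall>k. (k \<in> ?M \<longrightarrow> f k \<in> UNIV) \<and> (k \<notin> ?M \<longrightarrow> f k = 0)}"
      by (auto simp: total_degree_le_iff in_keys_iff)
    show "finite {f :: _ \<Rightarrow> 'a. \<forall>k. (k \<in> ?M \<longrightarrow> f k \<in> UNIV) \<and> (k \<notin> ?M \<longrightarrow> f k = 0)}"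
      using M by (rule finite_set_of_finite_funs) simp
  qed
  moreover have "inj_on Poly_Mapping.lookup {p :: ('n, 'a) mpoly. total_degree p \<le> t}"
    by (simp add: inj_on_def lookup_inject)
  ultimately show ?thesis
    by (rule finite_imageD)
qed

lemma subspace_degree_le_part:
  fixes V :: "('n::finite, 'a::field) mpoly set"
  assumes "mpoly_subspace V"
  shows "mpoly_subspace (degree_le_part V t)"
proof (rule mpoly.subspaceI)
  show "0 \<in> degree_le_part V t"
    using mpoly.subspace_0[OF assms] by (simp add: degree_le_part_def total_degree_le_iff)
  show "p + q \<in> degree_le_part V t"
    if "p \<in> degree_le_part V t" "q \<in> degree_le_part V t" for p q
    using that mpoly.subspace_add[OF assms] Poly_Mapping.keys_add[of p q]
    by (auto simp: degree_le_part_def total_degree_le_iff)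
  show "mpoly_scale c p \<in> degree_le_part V t" if "p \<in> degree_le_part V t" for c p
    using that mpoly.subspace_scale[OF assms]
    by (auto simp: degree_le_part_def total_degree_le_iff in_keys_iff lookup_mpoly_scale)
qed

text \<open>The finitely many generators have bounded degree, and so does their span.\<close>

lemma finite_if_finite_dim:
  fixes V :: "('n::finite, 'a::{field,finite}) mpoly set"
  assumes "mpoly_finite_dim V"
  shows "finite V"
proof -
  obtain B where B: "finite B" "mpoly_span B = V"
    using assms by (auto simp: mpoly_finite_dim_def)
  let ?D = "degree_le_part UNIV (Max (total_degree ` B)) :: ('n, 'a) mpoly set"
  have "B \<subseteq> ?D"
    using B(1) by (auto simp: degree_le_part_def)
  moreover have "mpoly_subspace ?D"
    by (rule subspace_degree_le_part) (rule mpoly.subspace_UNIV)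
  ultimately have "V \<subseteq> ?D"
    using mpoly.span_minimal B(2) by blast
  then show ?thesis
    using finite_total_degree_le by (auto simp: degree_le_part_def intro: finite_subset)
qed

lemma eventually_contains_functions:
  fixes V :: "('n::finite, 'a::{field,finite}) mpoly set"
  assumes "contains_functions V"
  shows "\<forall>\<^sub>F t in sequentially. contains_functions (degree_le_part V t)"
proof -
  obtain P where P: "P g \<in> V" "mpoly_eval (P g) = g" for g :: "'a ^ 'n \<Rightarrow> 'a"
    using assms unfolding contains_functions_def by metis
  have "contains_functions (degree_le_part V t)" if "t \<ge> Max (range (\<lambda>g. total_degree (P g)))" for t
    unfolding contains_functions_def
  proof
    fix g :: "'a ^ 'n \<Rightarrow> 'a"
    have "total_degree (P g) \<le> t"
      using that by (intro order_trans[OF Max_ge that]) auto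
    then show "\<exists>p\<in>degree_le_part V t. mpoly_eval p = g"
      using P by (auto simp: degree_le_part_def)
  qed
  then show ?thesis
    unfolding eventually_sequentially by blast
qed

section \<open>The distribution of the number of common zeros\<close>

theorem theorem1:
  fixes V :: "('n::finite, 'a::{field,finite}) mpoly set"
    and m n q :: nat
  assumes "n = CARD('n)" and "q = CARD('a)"
    and "m \<ge> 1"
    and "mpoly_subspace V"
    and "contains_functions V"
  shows "(mpoly_finite_dim V \<longrightarrow>
      (\<forall>r. real (card (systems_with_zeros m V r)) / real (card (tuples m V)) =
        real (q ^ n choose r) * (1 / real q ^ m) ^ r * (1 - 1 / real q ^ m) ^ (q ^ n - r))) \<and>
    (\<not> mpoly_finite_dim V \<longrightarrow>
      (\<forall>r. has_density m V (systems_with_zeros m V r)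
        (real (q ^ n choose r) * (1 / real q ^ m) ^ r * (1 - 1 / real q ^ m) ^ (q ^ n - r))))"
proof (intro conjI impI allI)
  fix r
  let ?d = "real (q ^ n choose r) * (1 / real q ^ m) ^ r * (1 - 1 / real q ^ m) ^ (q ^ n - r)"
  show "real (card (systems_with_zeros m V r)) / real (card (tuples m V)) = ?d"
    if "mpoly_finite_dim V"
    using proportion_systems_with_zeros[OF assms(4,5) finite_if_finite_dim[OF that]] assms(1,2)
    by simp
  have "systems_with_zeros m V r \<inter> tuples m (degree_le_part V t) =
      systems_with_zeros m (degree_le_part V t) r" for t
    by (auto simp: systems_with_zeros_def tuples_def degree_le_part_def PiE_def Pi_iff)
  moreover have "finite (degree_le_part V t)" for t
    using finite_total_degree_le by (rule finite_subset[rotated]) (auto simp: degree_le_part_def)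
  ultimately have "\<forall>\<^sub>F t in sequentially.
      real (card (systems_with_zeros m V r \<inter> tuples m (degree_le_part V t))) /
        real (card (tuples m (degree_le_part V t))) = ?d"
    using eventually_contains_functions[OF assms(5)]
      proportion_systems_with_zeros[OF subspace_degree_le_part[OF assms(4)]] assms(1,2)
    by (auto elim!: eventually_mono)
  then show "has_density m V (systems_with_zeros m V r) ?d"
    unfolding has_density_def by (rule tendsto_eventually)
qed

end
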